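(* Let $0<|q|<1$, let $\alpha>-1$ be real, and let $n,m$ be nonnegative integers. Put $x=q^{-m}$ and $y=q^{\alpha+1}$. Then \[ \sum_{k=0}^n\begin{bmatrix}n\\k\end{bmatrix}_q y^{n-k}x^k(y;q)_k=\sum_{k=0}^n\frac{(q^{-n},x,y;q)_k}{(q;q)_k}\,q^k . \]
   Context: $(x;q)_k=\prod_{j=0}^{k-1}(1-xq^j)$, $(x_1,\dots,x_r;q)_k=\prod_i(x_i;q)_k$, and $\begin{bmatrix}n\\k\end{bmatrix}_q=\frac{(q;q)_n}{(q;q)_k(q;q)_{n-k}}$. The paper presents this as the dual form of the discrete orthogonality relation of the $q$-Laguerre polynomials $L_n^{(\alpha)}(x;q)=\frac{1}{(q;q)_n}{}_2\phi_1(q^{-n},-x;0;q,q^{n+\alpha+1})$ (with respect to the points $cq^k$, $k\in\mathbb{Z}$, $c>0$). *)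

theory Defs
  imports "HOL-Analysis.Analysis"
begin

definition qpoch :: "'a::field \<Rightarrow> 'a \<Rightarrow> nat \<Rightarrow> 'a" where
  "qpoch x q k = (\<Prod>j<k. 1 - x * q ^ j)"

definition qpochs :: "'a::field list \<Rightarrow> 'a \<Rightarrow> nat \<Rightarrow> 'a" where
  "qpochs xs q k = (\<Prod>x\<leftarrow>xs. qpoch x q k)"

text \<open>
  Meant for \<open>k \<le> n\<close> only (the subtraction on naturals truncates), and for \<open>q\<close> such that
  the denominator does not vanish.
\<close>
definition qbinom :: "nat \<Rightarrow> nat \<Rightarrow> 'a::field \<Rightarrow> 'a" where
  "qbinom n k q = qpoch q q n / (qpoch q q k * qpoch q q (n - k))"

end

(*
  Expand x^k in the basis qpoch x q j by the q-Chu-Vandermonde sum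
  x^k = sum_j (q^-k; q)_j (x; q)_j q^j / (q; q)_j and interchange the summations. The claim then
  reduces, coefficient by coefficient, to
  sum_k [n, k] y^(n-k) (y; q)_k (q^-k; q)_j = (q^-n; q)_j (y; q)_j.
  Absorbing the first factor of (q^-k; q)_j into the q-binomial coefficient lowers n and j by one and
  replaces y by y q, which leaves the case j = 0, where the sum is 1.
*)
theory Submission
  imports Defs
begin

lemma qpoch_0 [simp]: "qpoch x q 0 = 1"
  by (simp add: qpoch_def)

lemma qpoch_Suc: "qpoch x q (Suc k) = qpoch x q k * (1 - x * q ^ k)"
  by (simp add: qpoch_def)

lemma qpoch_Suc_shift: "qpoch x q (Suc k) = (1 - x) * qpoch (x * q) q k"
  unfolding qpoch_def by (subst prod.lessThan_Suc_shift) (simp add: mult.assoc)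

lemma qpoch_1_Suc [simp]: "qpoch 1 q (Suc k) = 0"
  by (simp add: qpoch_Suc_shift)

lemma qpoch_inverse_power_Suc:
  fixes q :: "'a::field"
  assumes "q \<noteq> 0"
  shows "qpoch (inverse (q ^ Suc n)) q (Suc j) =
    (1 - inverse (q ^ Suc n)) * qpoch (inverse (q ^ n)) q j"
proof -
  have "inverse (q ^ Suc n) * q = inverse (q ^ n)"
    using assms by (simp add: field_simps)
  then show ?thesis
    by (simp only: qpoch_Suc_shift)
qed

text \<open>The algebraic content of 0 < |q| < 1: inverse powers of \<open>q\<close> make sense, and
  no factor of a denominator \<open>qpoch q q k\<close> vanishes.\<close>

locale not_root_of_unity =
  fixes q :: "'a::field"
  assumes q_nz: "q \<noteq> 0"
    and power_Suc_neq_1: "q ^ Suc k \<noteq> 1"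
begin

lemma qpoch_q_nz [simp]: "qpoch q q k \<noteq> 0"
  using power_Suc_neq_1 by (simp add: qpoch_def)

lemma qbinom_0 [simp]: "qbinom n 0 q = 1"
  by (simp add: qbinom_def)

lemma qbinom_self [simp]: "qbinom n n q = 1"
  by (simp add: qbinom_def)

text \<open>Of the two q-Pascal rules, this one puts the power on \<open>qbinom n k q\<close>, where
  it merges with \<open>z ^ (n - k)\<close> into \<open>(z * q) ^ (n - k)\<close>.\<close>

lemma qbinom_Suc_Suc:
  assumes "k < n"
  shows "qbinom (Suc n) (Suc k) q = qbinom n (Suc k) q + q ^ (n - k) * qbinom n k q"
proof -
  obtain i where i: "n = Suc (k + i)"
    using assms less_iff_Suc_add by blast
  have d: "1 - q * q ^ l \<noteq> 0" for l
    using power_Suc_neq_1[of l] by simp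
  show ?thesis
    using d[of k] d[of i] qpoch_q_nz[of k] qpoch_q_nz[of i]
    unfolding i qbinom_def
    by (simp add: qpoch_Suc Suc_diff_le divide_simps) (simp add: power_add algebra_simps)
qed

text \<open>The q-analogue of (k+1) C(n+1,k+1) = (n+1) C(n,k). Since 1 - q^(-i) = -q^(-i) (1 - q^i),
  passing to negative powers costs the factor \<open>q ^ (n - k)\<close>, which later turns
  \<open>y\<close> into \<open>y * q\<close>.\<close>

lemma qbinom_absorb:
  assumes "k \<le> n"
  shows "qbinom (Suc n) (Suc k) q * (1 - inverse (q ^ Suc k)) =
    (1 - inverse (q ^ Suc n)) * q ^ (n - k) * qbinom n k q"
proof -
  obtain i where i: "n = k + i"
    using assms le_iff_add by blast
  have d: "1 - q * q ^ k \<noteq> 0"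
    using power_Suc_neq_1[of k] by simp
  show ?thesis
    using d q_nz qpoch_q_nz[of k] qpoch_q_nz[of i]
    unfolding i qbinom_def
    by (simp add: qpoch_Suc divide_simps) (simp add: power_add algebra_simps)
qed

text \<open>By q-Pascal the sum for n+1 at z is z times the sum for n at z, plus 1 - z times the sum
  for n at z q. With both equal to 1, this gives z + (1 - z) = 1.\<close>

lemma sum_qbinom_power_qpoch:
  "(\<Sum>k\<le>n. qbinom n k q * z ^ (n - k) * qpoch z q k) = 1"
proof (induction n arbitrary: z)
  case 0
  show ?case by simp
next
  case (Suc n)
  \<comment> \<open>Truncated subtraction makes \<open>qbinom n (Suc n) q\<close> equal to 1/(1 -
    q^(n+1)) instead of 0; the padding by 0 extends Pascal's rule to k = n.\<close>
  let ?b = "\<lambda>k. if k \<le> n then qbinom n k q else 0"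
  have pascal: "qbinom (Suc n) (Suc k) q = ?b (Suc k) + q ^ (n - k) * qbinom n k q"
    if "k \<le> n" for k
    using that qbinom_Suc_Suc[of k n] by (cases "k = n") auto
  have "(\<Sum>k\<le>Suc n. qbinom (Suc n) k q * z ^ (Suc n - k) * qpoch z q k) =
      z ^ Suc n + (\<Sum>k\<le>n. qbinom (Suc n) (Suc k) q * z ^ (n - k) * qpoch z q (Suc k))"
    by (subst sum.atMost_Suc_shift) simp
  also have "(\<Sum>k\<le>n. qbinom (Suc n) (Suc k) q * z ^ (n - k) * qpoch z q (Suc k)) =
      (\<Sum>k\<le>n. ?b (Suc k) * z ^ (n - k) * qpoch z q (Suc k)) +
      (\<Sum>k\<le>n. (1 - z) * (qbinom n k q * (z * q) ^ (n - k) * qpoch (z * q) q k))"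
    unfolding sum.distrib[symmetric]
  proof (rule sum.cong[OF refl])
    fix k assume "k \<in> {..n}"
    then have k: "k \<le> n" by simp
    show "qbinom (Suc n) (Suc k) q * z ^ (n - k) * qpoch z q (Suc k) =
        ?b (Suc k) * z ^ (n - k) * qpoch z q (Suc k) +
        (1 - z) * (qbinom n k q * (z * q) ^ (n - k) * qpoch (z * q) q k)"
      unfolding pascal[OF k] qpoch_Suc_shift power_mult_distrib by (simp only: algebra_simps)
  qed
  also have "(\<Sum>k\<le>n. (1 - z) * (qbinom n k q * (z * q) ^ (n - k) * qpoch (z * q) q k)) = 1 - z"
    by (simp only: sum_distrib_left[symmetric] Suc.IH mult_1_right)
  \<comment> \<open>The isolated \<open>z ^ Suc n\<close> is the missing term k = 0 of the padded
    sum.\<close>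
  also have "z ^ Suc n + ((\<Sum>k\<le>n. ?b (Suc k) * z ^ (n - k) * qpoch z q (Suc k)) + (1 - z)) =
      (\<Sum>k\<le>Suc n. ?b k * z ^ (Suc n - k) * qpoch z q k) + (1 - z)"
    by (subst sum.atMost_Suc_shift) simp
  also have "(\<Sum>k\<le>Suc n. ?b k * z ^ (Suc n - k) * qpoch z q k) =
      z * (\<Sum>k\<le>n. qbinom n k q * z ^ (n - k) * qpoch z q k)"
    unfolding sum_distrib_left by (simp add: Suc_diff_le mult_ac)
  finally show ?case
    by (simp add: Suc.IH)
qed

lemma sum_qbinom_qpoch_qpoch:
  "(\<Sum>k\<le>n. qbinom n k q * y ^ (n - k) * qpoch y q k * qpoch (inverse (q ^ k)) q j) =
    qpoch (inverse (q ^ n)) q j * qpoch y q j"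
proof (induction j arbitrary: n y)
  case 0
  show ?case by (simp add: sum_qbinom_power_qpoch)
next
  case (Suc j)
  show ?case
  proof (cases n)
    case 0
    then show ?thesis by simp
  next
    case n: (Suc p)
    \<comment> \<open>The term k = 0 drops out, because \<open>qpoch 1 q (Suc j)\<close> contains
      the factor 1 - 1.\<close>
    have "(\<Sum>k\<le>n. qbinom n k q * y ^ (n - k) * qpoch y q k * qpoch (inverse (q ^ k)) q (Suc j)) =
        (\<Sum>k\<le>p. qbinom (Suc p) (Suc k) q * y ^ (p - k) * qpoch y q (Suc k) *
          qpoch (inverse (q ^ Suc k)) q (Suc j))"
      unfolding n by (subst sum.atMost_Suc_shift) simp
    also have "\<dots> = (\<Sum>k\<le>p. (1 - inverse (q ^ Suc p)) * (1 - y) *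
        (qbinom p k q * (y * q) ^ (p - k) * qpoch (y * q) q k * qpoch (inverse (q ^ k)) q j))"
    proof (rule sum.cong[OF refl])
      fix k assume "k \<in> {..p}"
      then have k: "k \<le> p" by simp
      have "qbinom (Suc p) (Suc k) q * y ^ (p - k) * qpoch y q (Suc k) *
          qpoch (inverse (q ^ Suc k)) q (Suc j) =
          (qbinom (Suc p) (Suc k) q * (1 - inverse (q ^ Suc k))) * y ^ (p - k) * (1 - y) *
          qpoch (y * q) q k * qpoch (inverse (q ^ k)) q j"
        unfolding qpoch_inverse_power_Suc[OF q_nz] qpoch_Suc_shift[of y] by (simp only: mult_ac)
      also have "\<dots> = (1 - inverse (q ^ Suc p)) * (1 - y) *
        (qbinom p k q * (y * q) ^ (p - k) * qpoch (y * q) q k * qpoch (inverse (q ^ k)) q j)"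
        unfolding qbinom_absorb[OF k] power_mult_distrib by (simp only: mult_ac)
      finally show "qbinom (Suc p) (Suc k) q * y ^ (p - k) * qpoch y q (Suc k) *
          qpoch (inverse (q ^ Suc k)) q (Suc j) = \<dots>" .
    qed
    also have "\<dots> = (1 - inverse (q ^ Suc p)) * (1 - y) *
        (qpoch (inverse (q ^ p)) q j * qpoch (y * q) q j)"
      by (simp only: sum_distrib_left[symmetric] Suc.IH)
    also have "\<dots> = qpoch (inverse (q ^ n)) q (Suc j) * qpoch y q (Suc j)"
      unfolding n qpoch_inverse_power_Suc[OF q_nz] qpoch_Suc_shift[of y] by (simp only: mult_ac)
    finally show ?thesis .
  qed
qed

text \<open>A recurrence in k for the coefficients of the expansion of x^k. After the common factor
  \<open>qpoch (inverse (q ^ k)) q j\<close> is taken out, the remaining linear factors differ by a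
  multiple of 1 - q^(j+1), which cancels the last factor of
  \<open>qpoch q q (Suc j)\<close>.\<close>

lemma qpoch_inverse_power_diff:
  "qpoch (inverse (q ^ Suc k)) q (Suc j) / qpoch q q (Suc j) * q ^ Suc j =
    qpoch (inverse (q ^ k)) q (Suc j) / qpoch q q (Suc j) * q ^ Suc j -
    inverse (q ^ k) * (qpoch (inverse (q ^ k)) q j / qpoch q q j * q ^ j)"
proof -
  have d: "1 - q * q ^ j \<noteq> 0"
    using power_Suc_neq_1[of j] by simp
  show ?thesis
    unfolding qpoch_inverse_power_Suc[OF q_nz] unfolding qpoch_Suc
    using d q_nz qpoch_q_nz[of j] by (simp add: divide_simps) (simp add: algebra_simps)
qed

text \<open>Terms with j > k vanish, so any bound n \<ge> k serves; a bound independent of k lets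
  the double sum be interchanged. The recurrence reduces the induction step to x^k - (1 - x) x^k =
  x^(k+1).\<close>

lemma power_eq_sum_qpoch:
  assumes "k \<le> n"
  shows "x ^ k = (\<Sum>j\<le>n. qpoch (inverse (q ^ k)) q j / qpoch q q j * q ^ j * qpoch x q j)"
  using assms
proof (induction k arbitrary: n x)
  case 0
  have "(\<Sum>j\<le>n. qpoch 1 q j / qpoch q q j * q ^ j * qpoch x q j) = (1::'a)"
    by (cases n) (simp_all add: sum.atMost_Suc_shift del: sum.atMost_Suc)
  then show ?case by simp
next
  case (Suc k)
  let ?c = "\<lambda>k j. qpoch (inverse (q ^ k)) q j / qpoch q q j * q ^ j"
  obtain p where n: "n = Suc p" and p: "k \<le> p"
    using Suc.prems by (cases n) auto
  have "(\<Sum>j\<le>n. ?c (Suc k) j * qpoch x q j) =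
      1 + (\<Sum>j\<le>p. ?c (Suc k) (Suc j) * qpoch x q (Suc j))"
    unfolding n by (subst sum.atMost_Suc_shift) simp
  also have "(\<Sum>j\<le>p. ?c (Suc k) (Suc j) * qpoch x q (Suc j)) =
      (\<Sum>j\<le>p. ?c k (Suc j) * qpoch x q (Suc j)) -
      (\<Sum>j\<le>p. inverse (q ^ k) * (1 - x) * (?c k j * qpoch (x * q) q j))"
    unfolding sum_subtractf[symmetric] qpoch_inverse_power_diff qpoch_Suc_shift[of x]
    by (intro sum.cong refl) (simp only: algebra_simps)
  \<comment> \<open>The induction hypothesis at \<open>x * q\<close> yields (x q)^k, whose power of
    q cancels against \<open>inverse (q ^ k)\<close>.\<close>
  also have "(\<Sum>j\<le>p. inverse (q ^ k) * (1 - x) * (?c k j * qpoch (x * q) q j)) =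
      (1 - x) * x ^ k"
    using q_nz unfolding sum_distrib_left[symmetric] Suc.IH[OF p, symmetric]
    by (simp add: power_mult_distrib)
  also have "1 + ((\<Sum>j\<le>p. ?c k (Suc j) * qpoch x q (Suc j)) - (1 - x) * x ^ k) =
      (\<Sum>j\<le>n. ?c k j * qpoch x q j) - (1 - x) * x ^ k"
    unfolding n by (subst sum.atMost_Suc_shift) simp
  also have "\<dots> = x ^ Suc k"
    unfolding Suc.IH[OF Suc_leD[OF Suc.prems], symmetric] by (simp add: algebra_simps)
  finally show ?case by simp
qed

theorem sum_qbinom_power_power_qpoch:
  "(\<Sum>k\<le>n. qbinom n k q * y ^ (n - k) * x ^ k * qpoch y q k) =
    (\<Sum>k\<le>n. qpochs [inverse (q ^ n), x, y] q k / qpoch q q k * q ^ k)"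
proof -
  have "(\<Sum>k\<le>n. qbinom n k q * y ^ (n - k) * x ^ k * qpoch y q k) =
      (\<Sum>k\<le>n. \<Sum>j\<le>n. qpoch x q j / qpoch q q j * q ^ j *
        (qbinom n k q * y ^ (n - k) * qpoch y q k * qpoch (inverse (q ^ k)) q j))"
  proof (rule sum.cong[OF refl])
    fix k assume "k \<in> {..n}"
    then have "x ^ k = (\<Sum>j\<le>n. qpoch (inverse (q ^ k)) q j / qpoch q q j * q ^ j * qpoch x q j)"
      by (intro power_eq_sum_qpoch) simp
    then show "qbinom n k q * y ^ (n - k) * x ^ k * qpoch y q k =
        (\<Sum>j\<le>n. qpoch x q j / qpoch q q j * q ^ j *
          (qbinom n k q * y ^ (n - k) * qpoch y q k * qpoch (inverse (q ^ k)) q j))"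
      by (simp add: sum_distrib_left sum_distrib_right mult_ac)
  qed
  also have "\<dots> = (\<Sum>j\<le>n. qpoch x q j / qpoch q q j * q ^ j *
      (qpoch (inverse (q ^ n)) q j * qpoch y q j))"
    by (subst sum.swap) (simp only: sum_distrib_left[symmetric] sum_qbinom_qpoch_qpoch)
  finally show ?thesis
    by (simp add: qpochs_def mult_ac)
qed

end

theorem theorem2p7:
  fixes q x y :: complex and \<alpha> :: real and n m :: nat
  assumes "0 < norm q" and "norm q < 1"
    and "\<alpha> > -1"
    and "x = q powi (- int m)"
    and "y = q powr (of_real (\<alpha> + 1))"
  shows "(\<Sum>k=0..n. qbinom n k q * y ^ (n - k) * x ^ k * qpoch y q k) =
    (\<Sum>k=0..n. qpochs [q powi (- int n), x, y] q k / qpoch q q k * q ^ k)"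
proof -
  \<comment> \<open>A positive power of q has norm below 1 and so differs from 1.\<close>
  interpret not_root_of_unity q
  proof
    show "q \<noteq> 0"
      using assms(1) by simp
    show "q ^ Suc k \<noteq> 1" for k
    proof
      assume "q ^ Suc k = 1"
      then have "norm q ^ Suc k = 1"
        by (metis norm_one norm_power)
      then show False
        using power_less_one_iff[of "norm q" "Suc k"] assms(2) by simp
    qed
  qed
  show ?thesis
    using sum_qbinom_power_power_qpoch[of n y x]
    by (simp add: atLeast0AtMost power_int_minus)
qed

end
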